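(* Let $G=(V,E)$ be a directed graph with $|V|=n$ and derived graph $G'=(V',E')$, $V'=S'\cup T'$. Fix any $\alpha \geq 1$, $d_{S'}, d_{T'} \geq 0$, $\epsilon \in (0,1)$, and $L = 2 \cdot (2 + \lceil \log_{(1+\epsilon)} n \rceil)$. Let $(S_1, \ldots, S_L), (T_1, \ldots, T_L)$ be an $(\alpha, d_{S'}, d_{T'}, L)$-decomposition of $G'$, and let $V'_L=S_L\cup T_L$. Then: 1. If $d_{S'} d_{T'} > 4 (1+\epsilon)\lambda_{S'} \lambda_{T'}$, then $V'_L = \emptyset$. 2. If $d_{S'} < \lambda_{S'}/\alpha$ and $d_{T'} < \lambda_{T'}/\alpha$, then $V'_L \ne \emptyset$.
   Context: For $X,Y\subseteq V$, $E(X,Y)=\{(u,v)\in E: u\in X,v\in Y\}$ and $\rho(X,Y)=|E(X,Y)|/\sqrt{|X||Y|}$; $\rho(G)=\max_{X,Y\subseteq V}\rho(X,Y)$. Derived graph: for each $v\in V$ create nodes $s_v,t_v$; $S'=\{s_v\}$, $T'=\{t_v\}$, $V'=S'\cup T'$, and $E'=\{(s_u,t_v):(u,v)\in E\}$. For $s\in S'$ and $T\subseteq T'$, $D_s(T)=|\{t\in T:(s,t)\in E'\}|$; for $t\in T'$, $S\subseteq S'$, $D_t(S)=|\{s\in S:(s,t)\in E'\}|$; $E'(S,T)$ is the set of edges of $E'$ from $S$ to $T$. Fix a densest pair $(S^*,T^* )$, $S^*\subseteq S'$, $T^*\subseteq T'$, with $|E'(S^*,T^* )|/\sqrt{|S^*||T^*|}=\rho(G)$,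 and define $\lambda_{S'}=|E'(S^*,T^* )|(1-\sqrt{1-1/|S^*|})$, $\lambda_{T'}=|E'(S^*,T^* )|(1-\sqrt{1-1/|T^*|})$. Families $S'=S_1\supseteq\cdots\supseteq S_L$ and $T'=T_1\supseteq\cdots\supseteq T_L$ form an $(\alpha,d_{S'},d_{T'},L)$-decomposition of $G'$ iff for every $i\in\{1,\dots,L-1\}$: $S_{i+1}\supseteq\{s\in S_i:D_s(T_i)>\alpha d_{S'}\}$, $S_{i+1}\cap\{s\in S_i:D_s(T_i)<d_{S'}\}=\emptyset$, $T_{i+1}\supseteq\{t\in T_i:D_t(S_i)>\alpha d_{T'}\}$, and $T_{i+1}\cap\{t\in T_i:D_t(S_i)<d_{T'}\}=\emptyset$. *)

theory Defs
  imports Complex_Main "Graph_Theory.Pair_Digraph"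
begin

definition edges_between :: "'a pair_pre_digraph \<Rightarrow> 'a set \<Rightarrow> 'a set \<Rightarrow> ('a \<times> 'a) set" where
  "edges_between G X Y = {(u, v). (u, v) \<in> parcs G \<and> u \<in> X \<and> v \<in> Y}"

definition pair_density :: "'a pair_pre_digraph \<Rightarrow> 'a set \<Rightarrow> 'a set \<Rightarrow> real" where
  "pair_density G X Y =
     real (card (edges_between G X Y)) / sqrt (real (card X) * real (card Y))"

(* The ratio is undefined when X or Y is empty, so the maximum ranges over nonempty
   sets; Max is meaningful when the vertex set is finite and nonempty. *)
definition max_density :: "'a pair_pre_digraph \<Rightarrow> real" where
  "max_density G =
     Max {pair_density G X Y | X Y.
            X \<subseteq> pverts G \<and> Y \<subseteq> pverts G \<and> X \<noteq> {} \<and> Y \<noteq> {}}"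

(* Inl v and Inr v are the two nodes s_v and t_v of the derived graph. *)
definition derived_S :: "'a pair_pre_digraph \<Rightarrow> ('a + 'a) set" where
  "derived_S G = {Inl v | v. v \<in> pverts G}"

definition derived_T :: "'a pair_pre_digraph \<Rightarrow> ('a + 'a) set" where
  "derived_T G = {Inr v | v. v \<in> pverts G}"

definition derived_graph :: "'a pair_pre_digraph \<Rightarrow> ('a + 'a) pair_pre_digraph" where
  "derived_graph G =
     \<lparr> pverts = derived_S G \<union> derived_T G,
       parcs = {(Inl u, Inr v) | u v. (u, v) \<in> parcs G} \<rparr>"

definition out_deg_to :: "'a pair_pre_digraph \<Rightarrow> 'a \<Rightarrow> 'a set \<Rightarrow> nat" where
  "out_deg_to H s T = card {t \<in> T. (s, t) \<in> parcs H}"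

definition in_deg_from :: "'a pair_pre_digraph \<Rightarrow> 'a \<Rightarrow> 'a set \<Rightarrow> nat" where
  "in_deg_from H t S = card {s \<in> S. (s, t) \<in> parcs H}"

definition densest_pair ::
    "'a pair_pre_digraph \<Rightarrow> ('a + 'a) set \<Rightarrow> ('a + 'a) set \<Rightarrow> bool" where
  "densest_pair G S T \<longleftrightarrow>
     S \<subseteq> derived_S G \<and> T \<subseteq> derived_T G \<and> S \<noteq> {} \<and> T \<noteq> {} \<and>
     pair_density (derived_graph G) S T = max_density G"

definition lambda_S ::
    "'a pair_pre_digraph \<Rightarrow> ('a + 'a) set \<Rightarrow> ('a + 'a) set \<Rightarrow> real" where
  "lambda_S G S T =
     real (card (edges_between (derived_graph G) S T)) * (1 - sqrt (1 - 1 / real (card S)))"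

definition lambda_T ::
    "'a pair_pre_digraph \<Rightarrow> ('a + 'a) set \<Rightarrow> ('a + 'a) set \<Rightarrow> real" where
  "lambda_T G S T =
     real (card (edges_between (derived_graph G) S T)) * (1 - sqrt (1 - 1 / real (card T)))"

(* The families are indexed 1, ..., L; their values at other indices are irrelevant. *)
definition is_decomposition ::
    "'a pair_pre_digraph \<Rightarrow> real \<Rightarrow> real \<Rightarrow> real \<Rightarrow> nat \<Rightarrow>
     (nat \<Rightarrow> ('a + 'a) set) \<Rightarrow> (nat \<Rightarrow> ('a + 'a) set) \<Rightarrow> bool" where
  "is_decomposition G \<alpha> dS dT L S T \<longleftrightarrow>
     S 1 = derived_S G \<and> T 1 = derived_T G \<and>
     (\<forall>i \<in> {1..<L}.
        S (i + 1) \<subseteq> S i \<and> T (i + 1) \<subseteq> T i \<and>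
        {s \<in> S i. real (out_deg_to (derived_graph G) s (T i)) > \<alpha> * dS} \<subseteq> S (i + 1) \<and>
        S (i + 1) \<inter> {s \<in> S i. real (out_deg_to (derived_graph G) s (T i)) < dS} = {} \<and>
        {t \<in> T i. real (in_deg_from (derived_graph G) t (S i)) > \<alpha> * dT} \<subseteq> T (i + 1) \<and>
        T (i + 1) \<inter> {t \<in> T i. real (in_deg_from (derived_graph G) t (S i)) < dT} = {})"

end

theory Submission
  imports Defs
begin

text \<open>
  Since \<open>1 - sqrt (1 - 1/a) \<ge> 1/(2a)\<close>, we have \<open>4 \<lambda>\<^sub>S \<lambda>\<^sub>T \<ge> \<rho>\<^sup>2\<close>. Every node of
  \<open>S\<^bsub>i+1\<^esub>\<close> has degree at least \<open>d\<^sub>S\<close> into \<open>T\<^sub>i\<close>, so the density bound gives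
  \<open>|S\<^bsub>i+1\<^esub>| d\<^sub>S\<^sup>2 \<le> \<rho>\<^sup>2 |T\<^sub>i|\<close>, and symmetrically for \<open>T\<close>. Multiplying the two, the
  product \<open>|S\<^sub>i| |T\<^sub>i|\<close> drops by a factor \<open>(1 + \<epsilon>)\<^sup>2\<close> in every step when
  \<open>d\<^sub>S d\<^sub>T > (1 + \<epsilon>) \<rho>\<^sup>2\<close>. Conversely, deleting one node from a densest pair cannot raise the
  density, so each node of \<open>S\<^sup>*\<close> has degree at least \<open>\<lambda>\<^sub>S\<close> into \<open>T\<^sup>*\<close>; below the
  thresholds, \<open>S\<^sup>*\<close> and \<open>T\<^sup>*\<close> therefore survive all steps.
\<close>

section \<open>Edge counts as degree sums\<close>

lemma card_edges_between_out:
  assumes "finite X" "finite Y"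
  shows "card (edges_between H X Y) = (\<Sum>s\<in>X. out_deg_to H s Y)"
proof -
  have "edges_between H X Y = Sigma X (\<lambda>s. {t \<in> Y. (s, t) \<in> parcs H})"
    by (auto simp: edges_between_def)
  then show ?thesis
    using assms by (simp add: out_deg_to_def)
qed

lemma card_edges_between_in:
  assumes "finite X" "finite Y"
  shows "card (edges_between H X Y) = (\<Sum>t\<in>Y. in_deg_from H t X)"
proof -
  have "edges_between H X Y = prod.swap ` Sigma Y (\<lambda>t. {s \<in> X. (s, t) \<in> parcs H})"
    by (auto simp: edges_between_def image_iff)
  then have "card (edges_between H X Y) = card (Sigma Y (\<lambda>t. {s \<in> X. (s, t) \<in> parcs H}))"
    by (simp add: card_image)
  then show ?thesis
    using assms by (simp add: in_deg_from_def)
qed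

lemma out_deg_to_mono:
  assumes "finite T'" "T \<subseteq> T'"
  shows "out_deg_to H s T \<le> out_deg_to H s T'"
  unfolding out_deg_to_def using assms by (intro card_mono) auto

lemma in_deg_from_mono:
  assumes "finite S'" "S \<subseteq> S'"
  shows "in_deg_from H t S \<le> in_deg_from H t S'"
  unfolding in_deg_from_def using assms by (intro card_mono) auto

section \<open>Densities in the derived graph\<close>

text \<open>The map \<open>map_prod Inl Inr\<close> is injective and carries edges to edges, so
  \<open>max_density G\<close>, a maximum over subsets of the original graph, also bounds densities
  in the derived graph.\<close>

lemma pair_density_derived:
  "pair_density (derived_graph G) (Inl ` X) (Inr ` Y) = pair_density G X Y"
proof -
  have "edges_between (derived_graph G) (Inl ` X) (Inr ` Y)
      = map_prod Inl Inr ` edges_between G X Y"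
    by (auto simp: edges_between_def derived_graph_def image_iff)
  moreover have "inj (map_prod Inl Inr :: 'a \<times> 'a \<Rightarrow> ('a + 'a) \<times> ('a + 'a))"
    by (simp add: prod.inj_map)
  ultimately show ?thesis
    by (simp add: pair_density_def card_image inj_on_subset)
qed

lemma pair_density_le_max_density:
  assumes "finite (pverts G)" "X \<subseteq> pverts G" "Y \<subseteq> pverts G" "X \<noteq> {}" "Y \<noteq> {}"
  shows "pair_density G X Y \<le> max_density G"
proof -
  let ?D = "{pair_density G X Y | X Y.
      X \<subseteq> pverts G \<and> Y \<subseteq> pverts G \<and> X \<noteq> {} \<and> Y \<noteq> {}}"
  have "?D \<subseteq> (\<lambda>(X, Y). pair_density G X Y) ` (Pow (pverts G) \<times> Pow (pverts G))"
    by auto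
  then have "finite ?D"
    by (rule finite_subset) (simp add: assms(1))
  then show ?thesis
    unfolding max_density_def by (rule Max_ge) (use assms in blast)
qed

lemma finite_derived:
  assumes "finite (pverts G)"
  shows "finite (derived_S G)" "finite (derived_T G)"
  using assms by (auto simp: derived_S_def derived_T_def)

lemma card_derived:
  "card (derived_S G) = card (pverts G)" "card (derived_T G) = card (pverts G)"
  by (auto simp: derived_S_def derived_T_def Setcompr_eq_image card_image)

text \<open>The form without division also covers empty sets, where both sides are 0. These arise
  when the only node of a side is deleted, or when a decomposition has died out.\<close>

lemma card_edges_derived_le:
  assumes fin: "finite (pverts G)" and X: "X \<subseteq> derived_S G" and Y: "Y \<subseteq> derived_T G"
  shows "real (card (edges_between (derived_graph G) X Y))
       \<le> max_density G * sqrt (real (card X) * real (card Y))"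
proof (cases "X = {} \<or> Y = {}")
  case True
  then show ?thesis by (auto simp: edges_between_def)
next
  case False
  obtain A where A: "X = Inl ` A" "A \<subseteq> pverts G"
    using X by (auto simp: derived_S_def Setcompr_eq_image subset_image_iff)
  obtain B where B: "Y = Inr ` B" "B \<subseteq> pverts G"
    using Y by (auto simp: derived_T_def Setcompr_eq_image subset_image_iff)
  have "pair_density (derived_graph G) X Y \<le> max_density G"
    unfolding A(1) B(1) pair_density_derived
    using pair_density_le_max_density[OF fin A(2) B(2)] A B False by auto
  moreover have "finite X" "finite Y"
    using fin X Y finite_derived finite_subset by blast+
  then have "0 < sqrt (real (card X) * real (card Y))"
    using False by (simp add: card_gt_0_iff)
  ultimately show ?thesis
    by (simp add: pair_density_def divide_le_eq)
qed

section \<open>Real inequalities\<close>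

lemma one_minus_sqrt_ge:
  fixes a :: nat
  assumes "a \<ge> 1"
  shows "1 / (2 * real a) \<le> 1 - sqrt (1 - 1 / real a)"
proof -
  \<comment> \<open>The square on the right exceeds the left side by
    \<open>1 / (4 * a^2)\<close>.\<close>
  have "1 - 1 / real a \<le> (1 - 1 / (2 * real a))\<^sup>2"
    using assms by (simp add: power2_eq_square field_simps)
  then have "sqrt (1 - 1 / real a) \<le> 1 - 1 / (2 * real a)"
    using assms by (intro real_le_lsqrt) (simp_all add: field_simps)
  then show ?thesis by simp
qed

text \<open>Squaring the chain \<open>x * d \<le> m \<le> \<rho> * sqrt (x * y)\<close> leaves one
  surplus factor \<open>x\<close> to cancel. In use, \<open>m\<close> counts edges, \<open>x\<close>
  and \<open>y\<close> are sizes of opposite sides, and \<open>d\<close> is a lower bound on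
  degrees.\<close>

lemma card_mult_square_le:
  fixes x y d m \<rho> :: real
  assumes "0 \<le> x" "0 \<le> y" "0 \<le> d" "x * d \<le> m" "m \<le> \<rho> * sqrt (x * y)"
  shows "x * d\<^sup>2 \<le> \<rho>\<^sup>2 * y"
proof (cases "x = 0")
  case True
  then show ?thesis using assms by simp
next
  case False
  have "(x * d)\<^sup>2 \<le> (\<rho> * sqrt (x * y))\<^sup>2"
    using assms by (intro power_mono) auto
  also have "\<dots> = x * (\<rho>\<^sup>2 * y)"
    using assms by (simp add: power_mult_distrib)
  finally have "x * (x * d\<^sup>2) \<le> x * (\<rho>\<^sup>2 * y)"
    by (simp add: power2_eq_square mult_ac)
  then show ?thesis
    using False assms(1) by (simp add: mult_le_cancel_left)
qed

text \<open>For \<open>a = 1\<close> the deletion leaves the empty set, and the bound says \<open>m \<le> k\<close>.\<close>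

lemma deletion_bound:
  fixes a b :: nat and m k \<rho> :: real
  assumes "a \<ge> 1" "b \<ge> 1"
    and m: "m = \<rho> * sqrt (real a * real b)"
    and "m - k \<le> \<rho> * sqrt (real (a - 1) * real b)"
  shows "m * (1 - sqrt (1 - 1 / real a)) \<le> k"
proof -
  have "real (a - 1) * real b = (real a * real b) * (1 - 1 / real a)"
    using assms(1) by (simp add: field_simps of_nat_diff)
  then have "\<rho> * sqrt (real (a - 1) * real b) = m * sqrt (1 - 1 / real a)"
    by (simp only: m real_sqrt_mult mult.assoc)
  then show ?thesis
    using assms(4) by (simp add: algebra_simps)
qed

section \<open>Degrees and lambda values of a densest pair\<close>

lemma densest_pair_card_edges:
  assumes fin: "finite (pverts G)" and "densest_pair G S T"
  shows "real (card (edges_between (derived_graph G) S T))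
       = max_density G * sqrt (real (card S) * real (card T))"
    and "card S \<ge> 1" and "card T \<ge> 1"
proof -
  have ST: "S \<subseteq> derived_S G" "T \<subseteq> derived_T G" "S \<noteq> {}" "T \<noteq> {}"
    and d: "pair_density (derived_graph G) S T = max_density G"
    using assms by (auto simp: densest_pair_def)
  have "finite S" "finite T"
    using fin ST finite_derived finite_subset by blast+
  with ST show "card S \<ge> 1" "card T \<ge> 1"
    by (auto simp: Suc_le_eq card_gt_0_iff)
  then show "real (card (edges_between (derived_graph G) S T))
       = max_density G * sqrt (real (card S) * real (card T))"
    using d by (simp add: pair_density_def field_simps)
qed

lemma lambda_S_le_out_deg:
  assumes fin: "finite (pverts G)" and dp: "densest_pair G S T" and s: "s \<in> S"
  shows "lambda_S G S T \<le> real (out_deg_to (derived_graph G) s T)"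
proof -
  let ?H = "derived_graph G"
  have ST: "S \<subseteq> derived_S G" "T \<subseteq> derived_T G"
    using dp by (auto simp: densest_pair_def)
  then have finST: "finite S" "finite T"
    using fin finite_derived finite_subset by blast+
  \<comment> \<open>Splitting off the summand of \<open>s\<close> shows that its deletion costs
    exactly its degree, the \<open>k\<close> of \<open>deletion_bound\<close>.\<close>
  have "card (edges_between ?H S T)
      = out_deg_to ?H s T + card (edges_between ?H (S - {s}) T)"
    using finST s by (simp add: card_edges_between_out sum.remove)
  moreover have "real (card (edges_between ?H (S - {s}) T))
      \<le> max_density G * sqrt (real (card S - 1) * real (card T))"
    using card_edges_derived_le[OF fin, of "S - {s}" T] ST s finST by auto
  ultimately show ?thesis
    unfolding lambda_S_def
    by (intro deletion_bound[OF densest_pair_card_edges(2,3,1)[OF fin dp]]) simp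
qed

lemma lambda_T_le_in_deg:
  assumes fin: "finite (pverts G)" and dp: "densest_pair G S T" and t: "t \<in> T"
  shows "lambda_T G S T \<le> real (in_deg_from (derived_graph G) t S)"
proof -
  let ?H = "derived_graph G"
  have ST: "S \<subseteq> derived_S G" "T \<subseteq> derived_T G"
    using dp by (auto simp: densest_pair_def)
  then have finST: "finite S" "finite T"
    using fin finite_derived finite_subset by blast+
  have "card (edges_between ?H S T)
      = in_deg_from ?H t S + card (edges_between ?H S (T - {t}))"
    using finST t by (simp add: card_edges_between_in sum.remove)
  moreover have "real (card (edges_between ?H S (T - {t})))
      \<le> max_density G * sqrt (real (card T - 1) * real (card S))"
    using card_edges_derived_le[OF fin, of S "T - {t}"] ST t finST by (auto simp: mult.commute)
  moreover have "real (card (edges_between ?H S T))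
      = max_density G * sqrt (real (card T) * real (card S))"
    using densest_pair_card_edges(1)[OF fin dp] by (simp add: mult.commute)
  ultimately show ?thesis
    unfolding lambda_T_def
    by (intro deletion_bound[OF densest_pair_card_edges(3,2)[OF fin dp]]) (assumption, linarith)
qed

text \<open>The lower bounds \<open>m / (2 * |S|)\<close> and \<open>m / (2 * |T|)\<close> on the
  lambda values have product \<open>m^2 / (4 * |S| * |T|)\<close>. Since \<open>m\<close> is the
  density times \<open>sqrt (|S| * |T|)\<close>, the sizes cancel.\<close>

lemma max_density_square_le:
  assumes fin: "finite (pverts G)" and dp: "densest_pair G S T"
  shows "(max_density G)\<^sup>2 \<le> 4 * lambda_S G S T * lambda_T G S T"
proof -
  define m where "m = real (card (edges_between (derived_graph G) S T))"
  note c = densest_pair_card_edges[OF fin dp]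
  have "m / (2 * real (card S)) \<le> lambda_S G S T"
    using mult_left_mono[OF one_minus_sqrt_ge[OF c(2)], of m] by (simp add: lambda_S_def m_def)
  moreover have "m / (2 * real (card T)) \<le> lambda_T G S T"
    using mult_left_mono[OF one_minus_sqrt_ge[OF c(3)], of m] by (simp add: lambda_T_def m_def)
  ultimately have "m / (2 * real (card S)) * (m / (2 * real (card T)))
      \<le> lambda_S G S T * lambda_T G S T"
    by (rule mult_mono') (simp_all add: m_def)
  moreover have "m\<^sup>2 = (max_density G)\<^sup>2 * (real (card S) * real (card T))"
    using c(1) by (simp add: m_def power_mult_distrib)
  then have "(max_density G)\<^sup>2 = 4 * (m / (2 * real (card S)) * (m / (2 * real (card T))))"
    using c(2,3) by (simp add: power2_eq_square field_simps)
  ultimately show ?thesis by simp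
qed

section \<open>Basic properties of decompositions\<close>

lemma decomposition_antimono:
  assumes dec: "is_decomposition G \<alpha> dS dT L S T" and "1 \<le> i" "i \<le> j" "j \<le> L"
  shows "S j \<subseteq> S i \<and> T j \<subseteq> T i"
  using assms(3,4)
proof (induction j rule: dec_induct)
  case (step j)
  then have "S (j + 1) \<subseteq> S j \<and> T (j + 1) \<subseteq> T j"
    using dec \<open>1 \<le> i\<close> unfolding is_decomposition_def by force
  with step show ?case by auto
qed simp

lemma decomposition_subset:
  assumes dec: "is_decomposition G \<alpha> dS dT L S T" and "1 \<le> i" "i \<le> L"
  shows "S i \<subseteq> derived_S G \<and> T i \<subseteq> derived_T G"
  using decomposition_antimono[OF dec order_refl assms(2,3)] dec
  by (simp add: is_decomposition_def)

lemma decomposition_degrees: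
  assumes dec: "is_decomposition G \<alpha> dS dT L S T" and i: "1 \<le> i" "i < L"
  shows "s \<in> S (i + 1) \<Longrightarrow> dS \<le> real (out_deg_to (derived_graph G) s (T i))"
    and "t \<in> T (i + 1) \<Longrightarrow> dT \<le> real (in_deg_from (derived_graph G) t (S i))"
proof -
  have *: "S (i + 1) \<subseteq> S i" "T (i + 1) \<subseteq> T i"
    "S (i + 1) \<inter> {s \<in> S i. real (out_deg_to (derived_graph G) s (T i)) < dS} = {}"
    "T (i + 1) \<inter> {t \<in> T i. real (in_deg_from (derived_graph G) t (S i)) < dT} = {}"
    using dec i unfolding is_decomposition_def by simp_all
  show "s \<in> S (i + 1) \<Longrightarrow> dS \<le> real (out_deg_to (derived_graph G) s (T i))"
    using *(1,3) by (auto simp: disjoint_iff subset_iff not_less)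
  show "t \<in> T (i + 1) \<Longrightarrow> dT \<le> real (in_deg_from (derived_graph G) t (S i))"
    using *(2,4) by (auto simp: disjoint_iff subset_iff not_less)
qed

section \<open>Decay of the product of sizes\<close>

text \<open>Survivors have large degree into the previous level of the other side, so the edges
  counted run between level \<open>i + 1\<close> and level \<open>i\<close>.\<close>

lemma decomposition_step:
  assumes fin: "finite (pverts G)" and dec: "is_decomposition G \<alpha> dS dT L S T"
    and i: "1 \<le> i" "i < L" and d: "0 \<le> dS" "0 \<le> dT"
  shows "real (card (S (i + 1))) * dS\<^sup>2 \<le> (max_density G)\<^sup>2 * real (card (T i))"
    and "real (card (T (i + 1))) * dT\<^sup>2 \<le> (max_density G)\<^sup>2 * real (card (S i))"
proof -
  let ?H = "derived_graph G"
  have sub: "S i \<subseteq> derived_S G" "T i \<subseteq> derived_T G"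
      "S (i + 1) \<subseteq> derived_S G" "T (i + 1) \<subseteq> derived_T G"
    using decomposition_subset[OF dec] i by auto
  then have fins: "finite (S i)" "finite (T i)" "finite (S (i + 1))" "finite (T (i + 1))"
    using fin finite_derived finite_subset by blast+
  have "real (card (S (i + 1))) * dS \<le> real (card (edges_between ?H (S (i + 1)) (T i)))"
    using sum_bounded_below[of "S (i + 1)" dS "\<lambda>s. real (out_deg_to ?H s (T i))"]
      decomposition_degrees(1)[OF dec i]
    by (simp only: card_edges_between_out[OF fins(3,2)] of_nat_sum)
  then show "real (card (S (i + 1))) * dS\<^sup>2 \<le> (max_density G)\<^sup>2 * real (card (T i))"
    using card_edges_derived_le[OF fin sub(3,2)] d
    by (intro card_mult_square_le) auto
  have "real (card (T (i + 1))) * dT \<le> real (card (edges_between ?H (S i) (T (i + 1))))"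
    using sum_bounded_below[of "T (i + 1)" dT "\<lambda>t. real (in_deg_from ?H t (S i))"]
      decomposition_degrees(2)[OF dec i]
    by (simp only: card_edges_between_in[OF fins(1,4)] of_nat_sum)
  then show "real (card (T (i + 1))) * dT\<^sup>2 \<le> (max_density G)\<^sup>2 * real (card (S i))"
    using card_edges_derived_le[OF fin sub(1,4)] d
    by (intro card_mult_square_le) (auto simp: mult.commute)
qed

text \<open>Each side is controlled by the other side's previous size, so the recursion closes only
  for the product. The index is \<open>k + 1\<close> because the families start at 1.\<close>

lemma decomposition_shrinks:
  fixes \<epsilon> :: real
  assumes fin: "finite (pverts G)" and dec: "is_decomposition G \<alpha> dS dT L S T"
    and d: "0 \<le> dS" "0 \<le> dT" and "0 < \<epsilon>"
    and large: "(1 + \<epsilon>) * (max_density G)\<^sup>2 < dS * dT"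
    and "k < L"
  shows "real (card (S (k + 1)) * card (T (k + 1))) * (1 + \<epsilon>) ^ (2 * k)
      \<le> (real (card (pverts G)))\<^sup>2"
  using \<open>k < L\<close>
proof (induction k)
  case 0
  then show ?case
    using dec by (simp add: is_decomposition_def card_derived power2_eq_square)
next
  case (Suc k)
  define \<rho> where "\<rho> = (max_density G)\<^sup>2"
  define p q where "p = real (card (S (k + 2)) * card (T (k + 2)))"
    and "q = real (card (S (k + 1)) * card (T (k + 1)))"
  have nn: "0 \<le> \<rho>" "0 \<le> p" "0 \<le> q"
    by (simp_all add: \<rho>_def p_def q_def)
  have step: "real (card (S (k + 2))) * dS\<^sup>2 \<le> \<rho> * real (card (T (k + 1)))"
    "real (card (T (k + 2))) * dT\<^sup>2 \<le> \<rho> * real (card (S (k + 1)))"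
    using decomposition_step[OF fin dec, of "k + 1"] Suc.prems d by (simp_all add: \<rho>_def)
  have "(real (card (S (k + 2))) * dS\<^sup>2) * (real (card (T (k + 2))) * dT\<^sup>2)
      \<le> (\<rho> * real (card (T (k + 1)))) * (\<rho> * real (card (S (k + 1))))"
    by (rule mult_mono'[OF step]) simp_all
  then have pq: "p * (dS * dT)\<^sup>2 \<le> \<rho>\<^sup>2 * q"
    by (simp add: p_def q_def power2_eq_square mult_ac)
  have "p * (1 + \<epsilon>)\<^sup>2 \<le> q"
  \<comment> \<open>The factor \<open>\<rho>\<^sup>2\<close> can be cancelled only if it is nonzero;
    for density 0 the bound \<open>pq\<close> forces \<open>p = 0\<close>.\<close>
  proof (cases "\<rho> = 0")
    case True
    then have "0 < dS * dT" using large by (simp add: \<rho>_def)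
    then have "p = 0"
      using pq True nn by (auto simp: mult_le_0_iff)
    then show ?thesis using nn by simp
  next
    case False
    have "((1 + \<epsilon>) * \<rho>)\<^sup>2 \<le> (dS * dT)\<^sup>2"
      using large nn \<open>0 < \<epsilon>\<close> by (intro power_mono) (auto simp: \<rho>_def)
    then have "p * ((1 + \<epsilon>) * \<rho>)\<^sup>2 \<le> \<rho>\<^sup>2 * q"
      using pq mult_left_mono[OF _ nn(2)] by (blast intro: order_trans)
    then have "\<rho>\<^sup>2 * (p * (1 + \<epsilon>)\<^sup>2) \<le> \<rho>\<^sup>2 * q"
      by (simp add: power_mult_distrib mult_ac)
    then show ?thesis
      using False by (simp add: mult_le_cancel_left)
  qed
  then have "p * (1 + \<epsilon>)\<^sup>2 * (1 + \<epsilon>) ^ (2 * k) \<le> q * (1 + \<epsilon>) ^ (2 * k)"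
    using \<open>0 < \<epsilon>\<close> by (intro mult_right_mono) auto
  also have "\<dots> \<le> (real (card (pverts G)))\<^sup>2"
    using Suc by (simp add: q_def)
  finally show ?case
    by (simp add: p_def power2_eq_square mult_ac)
qed

text \<open>After \<open>k\<close> steps the product of sizes is below 1, which empties one side.
  One further step empties the other, whose nodes now have degree 0; hence
  \<open>k + 2\<close>.\<close>

lemma decomposition_empty:
  fixes \<epsilon> :: real
  assumes fin: "finite (pverts G)" and dec: "is_decomposition G \<alpha> dS dT L S T"
    and d: "0 \<le> dS" "0 \<le> dT" and "0 < \<epsilon>"
    and large: "(1 + \<epsilon>) * (max_density G)\<^sup>2 < dS * dT"
    and k: "k + 2 \<le> L" "real (card (pverts G)) < (1 + \<epsilon>) ^ k"
  shows "S L \<union> T L = {}"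
proof -
  define c where "c = card (S (k + 1)) * card (T (k + 1))"
  have "real c * (1 + \<epsilon>) ^ (2 * k) \<le> (real (card (pverts G)))\<^sup>2"
    unfolding c_def using decomposition_shrinks[OF fin dec d \<open>0 < \<epsilon>\<close> large] k by simp
  also have "\<dots> < ((1 + \<epsilon>) ^ k)\<^sup>2"
    using k by (intro power_strict_mono) auto
  finally have "real c * (1 + \<epsilon>) ^ (2 * k) < 1 * (1 + \<epsilon>) ^ (2 * k)"
    by (simp add: power_mult mult.commute)
  \<comment> \<open>A natural number below 1.\<close>
  then have "c = 0"
    using \<open>0 < \<epsilon>\<close> by (simp add: mult_less_cancel_right)
  moreover have "S (k + 1) \<subseteq> derived_S G" "T (k + 1) \<subseteq> derived_T G"
    using decomposition_subset[OF dec, of "k + 1"] k by auto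
  then have "finite (S (k + 1))" "finite (T (k + 1))"
    using fin finite_derived finite_subset by blast+
  ultimately have one: "S (k + 1) = {} \<or> T (k + 1) = {}"
    by (auto simp: c_def)
  \<comment> \<open>Nodes of degree 0 are sure to be removed only when the thresholds are strictly
    positive.\<close>
  have "0 \<le> (1 + \<epsilon>) * (max_density G)\<^sup>2"
    using \<open>0 < \<epsilon>\<close> by simp
  then have "0 < dS * dT"
    using large by linarith
  then have pos: "0 < dS" "0 < dT"
    using d by (auto simp: zero_less_mult_iff)
  have deg: "S (k + 2) = {}" if "T (k + 1) = {}"
    using decomposition_degrees(1)[OF dec, of "k + 1"] k pos that
    by (fastforce simp: out_deg_to_def)
  have deg': "T (k + 2) = {}" if "S (k + 1) = {}"
    using decomposition_degrees(2)[OF dec, of "k + 1"] k pos that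
    by (fastforce simp: in_deg_from_def)
  have "S (k + 2) = {} \<and> T (k + 2) = {}"
    using one deg deg' decomposition_antimono[OF dec, of "k + 1" "k + 2"] k by auto
  then show ?thesis
    using decomposition_antimono[OF dec, of "k + 2" L] k by auto
qed

section \<open>Survival of the densest pair\<close>

text \<open>As long as level \<open>i\<close> contains the densest pair, degrees of its nodes into
  that level are at least those inside the pair, hence at least lambda and above
  \<open>\<alpha>\<close> times the threshold. Such nodes must be kept.\<close>

lemma densest_pair_survives:
  assumes fin: "finite (pverts G)" and dec: "is_decomposition G \<alpha> dS dT L S T"
    and dp: "densest_pair G Sstar Tstar"
    and small: "\<alpha> * dS < lambda_S G Sstar Tstar" "\<alpha> * dT < lambda_T G Sstar Tstar"
    and i: "1 \<le> i" "i \<le> L"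
  shows "Sstar \<subseteq> S i \<and> Tstar \<subseteq> T i"
  using i
proof (induction i rule: dec_induct)
  case base
  then show ?case using dec dp by (auto simp: is_decomposition_def densest_pair_def)
next
  case (step i)
  let ?H = "derived_graph G"
  have IH: "Sstar \<subseteq> S i" "Tstar \<subseteq> T i" using step by auto
  have "S i \<subseteq> derived_S G" "T i \<subseteq> derived_T G"
    using decomposition_subset[OF dec, of i] step by auto
  then have "finite (S i)" "finite (T i)"
    using fin finite_derived finite_subset by blast+
  then have mono: "out_deg_to ?H s Tstar \<le> out_deg_to ?H s (T i)"
    "in_deg_from ?H t Sstar \<le> in_deg_from ?H t (S i)" for s t
    using IH by (simp_all add: out_deg_to_mono in_deg_from_mono)
  have keep: "{s \<in> S i. real (out_deg_to ?H s (T i)) > \<alpha> * dS} \<subseteq> S (i + 1)"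
    "{t \<in> T i. real (in_deg_from ?H t (S i)) > \<alpha> * dT} \<subseteq> T (i + 1)"
    using dec step unfolding is_decomposition_def by simp_all
  have "s \<in> S (i + 1)" if "s \<in> Sstar" for s
    using lambda_S_le_out_deg[OF fin dp that] mono(1)[of s] small(1) IH(1) that
    by (intro subsetD[OF keep(1)]) auto
  moreover have "t \<in> T (i + 1)" if "t \<in> Tstar" for t
    using lambda_T_le_in_deg[OF fin dp that] mono(2)[of t] small(2) IH(2) that
    by (intro subsetD[OF keep(2)]) auto
  ultimately show ?case by auto
qed

theorem theorem6p6:
  fixes G :: "'a pair_pre_digraph"
    and n L :: nat
    and \<alpha> dS dT \<epsilon> :: real
    and Sstar Tstar :: "('a + 'a) set"
    and S T :: "nat \<Rightarrow> ('a + 'a) set"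
  assumes "pair_fin_digraph G"
    and "card (pverts G) = n"
    and "densest_pair G Sstar Tstar"
    and "\<alpha> \<ge> 1"
    and "dS \<ge> 0" and "dT \<ge> 0"
    and "0 < \<epsilon>" and "\<epsilon> < 1"
    and "int L = 2 * (2 + \<lceil>log (1 + \<epsilon>) (real n)\<rceil>)"
    and "is_decomposition G \<alpha> dS dT L S T"
  shows "(dS * dT > 4 * (1 + \<epsilon>) * lambda_S G Sstar Tstar * lambda_T G Sstar Tstar
            \<longrightarrow> S L \<union> T L = {})
       \<and> (dS < lambda_S G Sstar Tstar / \<alpha> \<and> dT < lambda_T G Sstar Tstar / \<alpha>
            \<longrightarrow> S L \<union> T L \<noteq> {})"
proof -
  have fin: "finite (pverts G)"
    using assms(1) by (rule pair_fin_digraph.pair_finite_verts)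
  note dp = assms(3) and dec = assms(10)
  have "Sstar \<subseteq> derived_S G" "Sstar \<noteq> {}"
    using dp by (auto simp: densest_pair_def)
  \<comment> \<open>A nonempty \<open>Sstar\<close> forces a vertex, so the logarithm is nonnegative
    and \<open>nat\<close> loses nothing in \<open>c\<close>.\<close>
  then have n: "n \<ge> 1"
    using fin assms(2) by (auto simp: derived_S_def Suc_le_eq card_gt_0_iff)
  define c where "c = nat \<lceil>log (1 + \<epsilon>) (real n)\<rceil>"
  have log: "0 \<le> log (1 + \<epsilon>) (real n)"
    using n assms(7) by simp
  then have c: "int c = \<lceil>log (1 + \<epsilon>) (real n)\<rceil>"
    by (simp add: c_def)
  then have L: "L = 2 * (2 + c)"
    using assms(9) by (simp flip: c)
  \<comment> \<open>With exponent \<open>c\<close> equality is possible, when \<open>n\<close> is a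
    power of \<open>1 + \<epsilon>\<close>; \<open>c + 1\<close> makes the bound strict, and
    \<open>c + 3 \<le> L\<close> leaves enough levels.\<close>
  have "log (1 + \<epsilon>) (real n) < real (c + 1)"
    using c by linarith
  then have "real n < (1 + \<epsilon>) ^ (c + 1)"
    using n assms(7) by (simp add: log_less_iff powr_realpow del: of_nat_add of_nat_Suc)
  then have "S L \<union> T L = {}"
    if "4 * (1 + \<epsilon>) * lambda_S G Sstar Tstar * lambda_T G Sstar Tstar < dS * dT"
  proof (intro decomposition_empty[OF fin dec assms(5,6,7), where k = "c + 1"])
    have "(1 + \<epsilon>) * (max_density G)\<^sup>2
        \<le> (1 + \<epsilon>) * (4 * lambda_S G Sstar Tstar * lambda_T G Sstar Tstar)"
      using max_density_square_le[OF fin dp] assms(7) by (intro mult_left_mono) auto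
    also have "\<dots> < dS * dT"
      using that by (simp add: algebra_simps)
    finally show "(1 + \<epsilon>) * (max_density G)\<^sup>2 < dS * dT" .
  qed (use L assms(2) in auto)
  moreover have "S L \<union> T L \<noteq> {}"
    if "dS < lambda_S G Sstar Tstar / \<alpha>" "dT < lambda_T G Sstar Tstar / \<alpha>"
    using densest_pair_survives[OF fin dec dp, of L] that L assms(4) \<open>Sstar \<noteq> {}\<close>
    by (auto simp: less_divide_eq mult.commute)
  ultimately show ?thesis by blast
qed

end
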